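(* Let $\Omega=\mathbb{R}^{\mathbb{N}}$ and let $\overleftarrow{\mathbb{E}}$ be a regular sublinear expectation on $(\Omega,C_b(\Omega))$ such that the coordinate process $\xi=(\xi_1,\xi_2,\dots)$ is contained in $L^{\gamma}_{\overleftarrow{\mathbb{E}}}(\Omega)$ for some $\gamma>1$ and is a sequence of $<$i.i.d. random variables under $\overleftarrow{\mathbb{E}}$. Let $$\overleftarrow{\Theta}=\{P\in\mathcal{M}_1(\Omega): E_P[X]\le\overleftarrow{\mathbb{E}}[X]\ \text{for any } X\in C_b(\Omega)\}$$ and let $\overleftarrow{\Theta}^e$ be the set of extreme points of the convex set $\overleftarrow{\Theta}$. Then, for any $A\in\mathcal{T}$ and $P\in\overleftarrow{\Theta}^e$, either $P(A)=0$ or $P(A)=1$.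
   Context: $\Omega=\mathbb{R}^{\mathbb{N}}$ carries the metric $d(x,y)=\sum_{k=1}^\infty 2^{-k}(|x(k)-y(k)|\wedge1)$ (a Polish space); $\xi_k(\omega)=\omega(k)$. $\mathcal{G}_n=\sigma\{\xi_n,\xi_{n+1},\dots\}$ and $\mathcal{T}=\bigcap_n\mathcal{G}_n$ is the tail $\sigma$-algebra. $\mathcal{M}_1(\Omega)$ denotes the Borel probability measures on $\Omega$, and $C_b(\Omega)$ the bounded continuous functions. A sublinear expectation on $(\Omega,C_b(\Omega))$ is a functional of the form $X\mapsto\sup_{P\in\Theta'}E_P[X]$ for some set $\Theta'\subset\mathcal{M}_1(\Omega)$. It is regular if its values on $X_n$ decrease to $0$ whenever $X_n\in C_b(\Omega)$ and $X_n\downarrow0$ pointwise on $\Omega$. For $p\ge1$, $L^p_{\overleftarrow{\mathbb{E}}}(\Omega)$ is the completion of $C_b(\Omega)$ under $\|X\|_p=(\overleftarrow{\mathbb{E}}[|X|^p])^{1/p}$, identified with Borel functions $X$ for which there are $X_n\in C_b(\Omega)$ with $\sup_{P\in\overleftarrow{\Theta}}E_P[|X-X_n|^p]\to0$ (modulo sets null under every $P\in\overleftarrow{\Theta}$); for such $X$, $\overleftarrow{\mathbb{E}}[X]=\sup_{P\in\overleftarrow{\Theta}}E_P[X]$. $C_{b,Lip}(\mathbb{R}^n)$: bounded Lipschitz functions on $\mathbb{R}^n$. Under a sublinear expectation $\mathbb{E}$, $\mathbf{X}$ ($m$-dimensional) is independent of $\mathbf{Y}$ ($n$-dimensional) if $\mathbb{E}[\varphi(\mathbf{Y},\mathbf{X})]=\mathbb{E}\big[\mathbb{E}[\varphi(\mathbf{y},\mathbf{X})]|_{\mathbf{y}=\mathbf{Y}}\big]$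 for any $\varphi\in C_{b,Lip}(\mathbb{R}^{n+m})$ (not a symmetric relation). $\mathbf{X}\overset{d}{=}\mathbf{Y}$ means $\mathbb{E}[\varphi(\mathbf{X})]=\mathbb{E}[\varphi(\mathbf{Y})]$ for every bounded Lipschitz $\varphi$. $(X_i)_{i\ge1}$ is called $<$i.i.d. if, for all $i,j\ge1$, $X_i$ is independent of $(X_{i+1},\dots,X_{i+j})$ and $X_{i+1}\overset{d}{=}X_i$. *)

theory Defs
  imports "HOL-Probability.Probability"
begin

text \<open>
  Sequences are indexed from 0, so the coordinate written $\xi_{k+1}$ in the usual one-based
  notation is \<open>xi k\<close>.  Only the topology of $\Omega$ matters below: the library's
  topology on functions is the product topology, which is the one induced by the metric
  $\sum_k 2^{-k} (|x(k)-y(k)| \wedge 1)$, and \<open>bcontfun\<close> is the set $C_b(\Omega)$.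
\<close>

type_synonym Omega = "nat \<Rightarrow> real"

definition xi :: "nat \<Rightarrow> Omega \<Rightarrow> real" where
  "xi k \<omega> = \<omega> k"

definition tail_from :: "nat \<Rightarrow> Omega set set" where
  "tail_from n = sigma_sets UNIV (\<Union>k\<in>{n..}. {xi k -` B | B. B \<in> sets borel})"

definition tail_algebra :: "Omega set set" where
  "tail_algebra = (\<Inter>n. tail_from n)"

definition borel_probs :: "Omega measure set" where
  "borel_probs = {P. prob_space P \<and> sets P = sets borel}"

text \<open>
  A functional on $C_b(\Omega)$ is a total function whose values outside \<open>bcontfun\<close> are
  irrelevant.  The representing set is nonempty since the functional is real-valued; the
  supremum is then that of a nonempty bounded set of reals.
\<close>

definition sublinear_expectation :: "((Omega \<Rightarrow> real) \<Rightarrow> real) \<Rightarrow> bool" where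
  "sublinear_expectation E \<longleftrightarrow>
     (\<exists>\<Theta>'. \<Theta>' \<noteq> {} \<and> \<Theta>' \<subseteq> borel_probs \<and>
       (\<forall>X\<in>bcontfun. E X = (SUP P\<in>\<Theta>'. integral\<^sup>L P X)))"

definition regular_expectation :: "((Omega \<Rightarrow> real) \<Rightarrow> real) \<Rightarrow> bool" where
  "regular_expectation E \<longleftrightarrow>
     (\<forall>X :: nat \<Rightarrow> Omega \<Rightarrow> real.
        (\<forall>n. X n \<in> bcontfun) \<longrightarrow>
        (\<forall>\<omega>. decseq (\<lambda>n. X n \<omega>) \<and> (\<lambda>n. X n \<omega>) \<longlonglongrightarrow> 0) \<longrightarrow>
        decseq (\<lambda>n. E (X n)) \<and> (\<lambda>n. E (X n)) \<longlonglongrightarrow> 0)"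

definition Theta :: "((Omega \<Rightarrow> real) \<Rightarrow> real) \<Rightarrow> Omega measure set" where
  "Theta E = {P \<in> borel_probs. \<forall>X\<in>bcontfun. integral\<^sup>L P X \<le> E X}"

text \<open>
  Measures do not form a real vector space in the library, so the identity
  $P = t Q + (1-t) R$ is stated on Borel sets.
\<close>

definition extreme_measures :: "Omega measure set \<Rightarrow> Omega measure set" where
  "extreme_measures K = {P \<in> K. \<forall>Q\<in>K. \<forall>R\<in>K. \<forall>t::real.
     0 < t \<longrightarrow> t < 1 \<longrightarrow>
     (\<forall>B\<in>sets borel. measure P B = t * measure Q B + (1 - t) * measure R B) \<longrightarrow>
     Q = P \<and> R = P}"

text \<open>
  Elements of $L^p$ are represented by Borel functions, not by equivalence classes.  The
  supremum is taken in the extended nonnegative reals, so no integrability is presupposed.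
\<close>

definition Lp_space :: "((Omega \<Rightarrow> real) \<Rightarrow> real) \<Rightarrow> real \<Rightarrow> (Omega \<Rightarrow> real) set" where
  "Lp_space E p = {X \<in> borel_measurable borel.
     \<exists>Y :: nat \<Rightarrow> Omega \<Rightarrow> real. (\<forall>n. Y n \<in> bcontfun) \<and>
       (\<lambda>n. SUP P\<in>Theta E. \<integral>\<^sup>+\<omega>. ennreal (\<bar>X \<omega> - Y n \<omega>\<bar> powr p) \<partial>P) \<longlonglongrightarrow> 0}"

definition extended_expectation ::
    "((Omega \<Rightarrow> real) \<Rightarrow> real) \<Rightarrow> (Omega \<Rightarrow> real) \<Rightarrow> real" where
  "extended_expectation E X = (SUP P\<in>Theta E. integral\<^sup>L P X)"

text \<open>
  A vector in $\mathbb{R}^n$ is a list of length $n$ and $(y, x)$ is \<open>y @ x\<close>; a function on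
  $\mathbb{R}^n$ is constrained only on lists of length $n$.
\<close>

definition bounded_Lipschitz :: "nat \<Rightarrow> (real list \<Rightarrow> real) set" where
  "bounded_Lipschitz n = {\<phi>.
     (\<exists>B. \<forall>x. length x = n \<longrightarrow> \<bar>\<phi> x\<bar> \<le> B) \<and>
     (\<exists>L. \<forall>x y. length x = n \<longrightarrow> length y = n \<longrightarrow>
        \<bar>\<phi> x - \<phi> y\<bar> \<le> L * L2_set (\<lambda>i. x ! i - y ! i) {..<n})}"

text \<open>\<open>independent_of E m X n Y\<close>: the $m$-dimensional \<open>X\<close> is independent of the
  $n$-dimensional \<open>Y\<close> (the order matters).\<close>

definition independent_of :: "((Omega \<Rightarrow> real) \<Rightarrow> real) \<Rightarrow>
    nat \<Rightarrow> (Omega \<Rightarrow> real list) \<Rightarrow> nat \<Rightarrow> (Omega \<Rightarrow> real list) \<Rightarrow> bool" where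
  "independent_of E m X n Y \<longleftrightarrow>
     (\<forall>\<phi>\<in>bounded_Lipschitz (n + m).
        E (\<lambda>\<omega>. \<phi> (Y \<omega> @ X \<omega>)) = E (\<lambda>\<omega>. E (\<lambda>\<omega>'. \<phi> (Y \<omega> @ X \<omega>'))))"

definition same_distribution :: "((Omega \<Rightarrow> real) \<Rightarrow> real) \<Rightarrow>
    nat \<Rightarrow> (Omega \<Rightarrow> real list) \<Rightarrow> (Omega \<Rightarrow> real list) \<Rightarrow> bool" where
  "same_distribution E n X Y \<longleftrightarrow>
     (\<forall>\<phi>\<in>bounded_Lipschitz n. E (\<lambda>\<omega>. \<phi> (X \<omega>)) = E (\<lambda>\<omega>. \<phi> (Y \<omega>)))"

definition backward_iid :: "((Omega \<Rightarrow> real) \<Rightarrow> real) \<Rightarrow> (nat \<Rightarrow> Omega \<Rightarrow> real) \<Rightarrow> bool" where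
  "backward_iid E X \<longleftrightarrow>
     (\<forall>i. \<forall>j\<ge>1.
        independent_of E 1 (\<lambda>\<omega>. [X i \<omega>]) j (\<lambda>\<omega>. map (\<lambda>k. X k \<omega>) [i + 1..<i + j + 1]) \<and>
        same_distribution E 1 (\<lambda>\<omega>. [X (i + 1) \<omega>]) (\<lambda>\<omega>. [X i \<omega>]))"

end

theory Submission imports Defs begin

text \<open>
  Write \<open>\<E>\<close> for \<open>extended_expectation E\<close>, the supremum of the integrals over
  \<open>Theta E\<close>.  Under backward independence \<open>\<E>\<close> is computed by integrating
  out the coordinates in increasing order, each one with all later coordinates held fixed.
  A member \<open>P\<close> of \<open>Theta E\<close> is therefore a measure whose conditional law of each
  coordinate given all \<^emph>\<open>later\<close> ones obeys the one-dimensional bound.  A tail event is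
  determined by the later coordinates, so conditioning \<open>P\<close> on a tail event \<open>A\<close>
  changes none of these conditional laws and leaves \<open>P\<close> inside \<open>Theta E\<close>.  If
  \<open>0 < P(A) < 1\<close>, then \<open>P\<close> is a proper mixture of its conditionings on \<open>A\<close>
  and on the complement of \<open>A\<close>, which are two members of \<open>Theta E\<close> different from
  \<open>P\<close>, and so \<open>P\<close> is not extreme.

  The argument avoids conditional laws.  Let \<open>f\<close> depend on the coordinates before
  \<open>n\<close> and \<open>g \<ge> 0\<close> on finitely many coordinates from \<open>n\<close> on, both bounded
  and Lipschitz.  Integrating out the first \<open>n\<close> coordinates, with \<open>g\<close> pulled out as a
  nonnegative constant each time, gives \<open>\<E>(f g) = \<E>(\<E>(f) g)\<close>
  (\<open>extended_expectation_mult_later\<close>).  Applied to \<open>f - \<E>(f)\<close> this yields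
  \<open>E\<^sub>P[(f - \<E>(f)) g] \<le> 0\<close> for every \<open>P\<close> in \<open>Theta E\<close>
  (\<open>integral_mult_later_le\<close>).  Approximating the indicator of a tail event in
  \<open>L\<^sup>1(P)\<close> by such \<open>g\<close>, and a bounded continuous \<open>X\<close> pointwise from below
  by such \<open>f\<close>, turns this into \<open>E\<^sub>P[X; A] \<le> E(X) P(A)\<close>
  (\<open>integral_indicator_tail_le\<close>), which says that \<open>P\<close> conditioned on \<open>A\<close> lies
  in \<open>Theta E\<close>.
\<close>

section \<open>Bounded Lipschitz functions of finitely many coordinates\<close>

text \<open>The Lipschitz bound in the coordinates \<open>a, \<dots>, b - 1\<close> alone also expresses that
  \<open>f\<close> depends on no other coordinate (see \<open>cylinder_Lipschitz_cong\<close>).  Functions on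
  \<open>\<Omega>\<close> with a window of coordinates replace functions on lists, so that no reindexing is
  needed when coordinates are fixed or integrated out.\<close>

definition cylinder_Lipschitz :: "nat \<Rightarrow> nat \<Rightarrow> (Omega \<Rightarrow> real) \<Rightarrow> bool" where
  "cylinder_Lipschitz a b f \<longleftrightarrow>
     (\<exists>B. \<forall>x. \<bar>f x\<bar> \<le> B) \<and>
     (\<exists>L\<ge>0. \<forall>x y. \<bar>f x - f y\<bar> \<le> L * (\<Sum>k\<in>{a..<b}. \<bar>x k - y k\<bar>))"

lemma cylinder_LipschitzI:
  assumes "\<And>x. \<bar>f x\<bar> \<le> B" "L \<ge> 0"
    and "\<And>x y. \<bar>f x - f y\<bar> \<le> L * (\<Sum>k\<in>{a..<b}. \<bar>x k - y k\<bar>)"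
  shows "cylinder_Lipschitz a b f"
  using assms unfolding cylinder_Lipschitz_def by blast

lemma cylinder_LipschitzE:
  assumes "cylinder_Lipschitz a b f"
  obtains B L where "\<And>x. \<bar>f x\<bar> \<le> B" "0 \<le> B" "L \<ge> 0"
    and "\<And>x y. \<bar>f x - f y\<bar> \<le> L * (\<Sum>k\<in>{a..<b}. \<bar>x k - y k\<bar>)"
proof -
  obtain B L where *: "\<And>x. \<bar>f x\<bar> \<le> B" "L \<ge> 0"
      "\<And>x y. \<bar>f x - f y\<bar> \<le> L * (\<Sum>k\<in>{a..<b}. \<bar>x k - y k\<bar>)"
    using assms unfolding cylinder_Lipschitz_def by blast
  have "0 \<le> B" using *(1)[of undefined] by linarith
  with * show thesis by (intro that)
qed

lemma cylinder_Lipschitz_cong: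
  assumes "cylinder_Lipschitz a b f" and "\<And>k. a \<le> k \<Longrightarrow> k < b \<Longrightarrow> x k = y k"
  shows "f x = f y"
proof -
  obtain L where "\<bar>f x - f y\<bar> \<le> L * (\<Sum>k\<in>{a..<b}. \<bar>x k - y k\<bar>)"
    using cylinder_LipschitzE[OF assms(1)] by metis
  also have "\<dots> = 0" using assms(2) by simp
  finally show ?thesis by simp
qed

lemma cylinder_Lipschitz_const: "cylinder_Lipschitz a b (\<lambda>_. c)"
  by (rule cylinder_LipschitzI[of _ "\<bar>c\<bar>" 0]) auto

lemma cylinder_Lipschitz_mono:
  assumes f: "cylinder_Lipschitz a b f" and "a' \<le> a" "b \<le> b'"
  shows "cylinder_Lipschitz a' b' f"
proof -
  obtain B L where *: "\<And>x. \<bar>f x\<bar> \<le> B" "L \<ge> 0"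
      "\<And>x y. \<bar>f x - f y\<bar> \<le> L * (\<Sum>k\<in>{a..<b}. \<bar>x k - y k\<bar>)"
    using cylinder_LipschitzE[OF f] by metis
  show ?thesis
  proof (rule cylinder_LipschitzI)
    fix x y :: Omega
    have "(\<Sum>k\<in>{a..<b}. \<bar>x k - y k\<bar>) \<le> (\<Sum>k\<in>{a'..<b'}. \<bar>x k - y k\<bar>)"
      using assms by (intro sum_mono2) auto
    with *(2) have "L * (\<Sum>k\<in>{a..<b}. \<bar>x k - y k\<bar>) \<le> L * (\<Sum>k\<in>{a'..<b'}. \<bar>x k - y k\<bar>)"
      by (rule mult_left_mono[rotated])
    with *(3)[of x y] show "\<bar>f x - f y\<bar> \<le> L * (\<Sum>k\<in>{a'..<b'}. \<bar>x k - y k\<bar>)" by linarith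
  qed (use * in auto)
qed

lemma cylinder_Lipschitz_mult:
  assumes f: "cylinder_Lipschitz a b f" and g: "cylinder_Lipschitz a b g"
  shows "cylinder_Lipschitz a b (\<lambda>x. f x * g x)"
proof -
  obtain B L where F: "\<And>x. \<bar>f x\<bar> \<le> B" "0 \<le> B" "L \<ge> 0"
      "\<And>x y. \<bar>f x - f y\<bar> \<le> L * (\<Sum>k\<in>{a..<b}. \<bar>x k - y k\<bar>)"
    using cylinder_LipschitzE[OF f] by metis
  obtain B' L' where G: "\<And>x. \<bar>g x\<bar> \<le> B'" "0 \<le> B'" "L' \<ge> 0"
      "\<And>x y. \<bar>g x - g y\<bar> \<le> L' * (\<Sum>k\<in>{a..<b}. \<bar>x k - y k\<bar>)"
    using cylinder_LipschitzE[OF g] by metis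
  show ?thesis
  proof (rule cylinder_LipschitzI)
    show "\<bar>f x * g x\<bar> \<le> B * B'" for x
      unfolding abs_mult using F G by (intro mult_mono) auto
    show "0 \<le> B * L' + L * B'" using F G by simp
    fix x y :: Omega
    let ?S = "\<Sum>k\<in>{a..<b}. \<bar>x k - y k\<bar>"
    have "f x * g x - f y * g y = f x * (g x - g y) + (f x - f y) * g y"
      by (simp add: algebra_simps)
    then have "\<bar>f x * g x - f y * g y\<bar> \<le> \<bar>f x\<bar> * \<bar>g x - g y\<bar> + \<bar>f x - f y\<bar> * \<bar>g y\<bar>"
      by (metis abs_mult abs_triangle_ineq)
    also have "\<dots> \<le> B * (L' * ?S) + (L * ?S) * B'"
      using F G by (intro add_mono mult_mono) (auto intro!: mult_nonneg_nonneg sum_nonneg)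
    finally show "\<bar>f x * g x - f y * g y\<bar> \<le> (B * L' + L * B') * ?S"
      by (simp add: algebra_simps)
  qed
qed

lemma cylinder_Lipschitz_diff:
  assumes f: "cylinder_Lipschitz a b f" and g: "cylinder_Lipschitz a b g"
  shows "cylinder_Lipschitz a b (\<lambda>x. f x - g x)"
proof -
  obtain B L where F: "\<And>x. \<bar>f x\<bar> \<le> B" "L \<ge> 0"
      "\<And>x y. \<bar>f x - f y\<bar> \<le> L * (\<Sum>k\<in>{a..<b}. \<bar>x k - y k\<bar>)"
    using cylinder_LipschitzE[OF f] by metis
  obtain B' L' where G: "\<And>x. \<bar>g x\<bar> \<le> B'" "L' \<ge> 0"
      "\<And>x y. \<bar>g x - g y\<bar> \<le> L' * (\<Sum>k\<in>{a..<b}. \<bar>x k - y k\<bar>)"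
    using cylinder_LipschitzE[OF g] by metis
  show ?thesis
  proof (rule cylinder_LipschitzI)
    show "\<bar>f x - g x\<bar> \<le> B + B'" for x
      using F(1)[of x] G(1)[of x] by linarith
    show "0 \<le> L + L'" using F G by simp
    show "\<bar>f x - g x - (f y - g y)\<bar> \<le> (L + L') * (\<Sum>k\<in>{a..<b}. \<bar>x k - y k\<bar>)" for x y
      using F(3)[of x y] G(3)[of x y] unfolding distrib_right by linarith
  qed
qed

lemma cylinder_Lipschitz_max:
  assumes f: "cylinder_Lipschitz a b f" and g: "cylinder_Lipschitz a b g"
  shows "cylinder_Lipschitz a b (\<lambda>x. max (f x) (g x))"
proof -
  obtain B L where F: "\<And>x. \<bar>f x\<bar> \<le> B" "L \<ge> 0"
      "\<And>x y. \<bar>f x - f y\<bar> \<le> L * (\<Sum>k\<in>{a..<b}. \<bar>x k - y k\<bar>)"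
    using cylinder_LipschitzE[OF f] by metis
  obtain B' L' where G: "\<And>x. \<bar>g x\<bar> \<le> B'" "L' \<ge> 0"
      "\<And>x y. \<bar>g x - g y\<bar> \<le> L' * (\<Sum>k\<in>{a..<b}. \<bar>x k - y k\<bar>)"
    using cylinder_LipschitzE[OF g] by metis
  show ?thesis
  proof (rule cylinder_LipschitzI)
    show "\<bar>max (f x) (g x)\<bar> \<le> max B B'" for x
      using F(1)[of x] G(1)[of x] by linarith
    show "0 \<le> max L L'" using F G by simp
    fix x y :: Omega
    let ?S = "\<Sum>k\<in>{a..<b}. \<bar>x k - y k\<bar>"
    have "L * ?S \<le> max L L' * ?S" "L' * ?S \<le> max L L' * ?S"
      by (intro mult_right_mono sum_nonneg; simp)+
    then show "\<bar>max (f x) (g x) - max (f y) (g y)\<bar> \<le> max L L' * ?S"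
      using F(3)[of x y] G(3)[of x y] by linarith
  qed
qed

lemma continuous_on_cylinder_Lipschitz:
  assumes "cylinder_Lipschitz a b f"
  shows "continuous_on UNIV f"
proof -
  obtain L where L: "\<And>x y. \<bar>f x - f y\<bar> \<le> L * (\<Sum>k\<in>{a..<b}. \<bar>x k - y k\<bar>)"
    using cylinder_LipschitzE[OF assms] by metis
  have "(f \<longlongrightarrow> f x) (at x)" for x
  proof -
    have coord: "((\<lambda>y. y k) \<longlongrightarrow> x k) (at x)" for k
      using continuous_on_product_coordinates[where ?'b = real, of k]
      by (simp add: continuous_on_def)
    have "((\<lambda>y. L * (\<Sum>k\<in>{a..<b}. \<bar>y k - x k\<bar>)) \<longlongrightarrow> L * (\<Sum>k\<in>{a..<b}. \<bar>x k - x k\<bar>)) (at x)"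
      by (intro tendsto_intros coord)
    then have "((\<lambda>y. L * (\<Sum>k\<in>{a..<b}. \<bar>y k - x k\<bar>)) \<longlongrightarrow> 0) (at x)" by simp
    moreover have "eventually (\<lambda>y. norm (f y - f x) \<le> L * (\<Sum>k\<in>{a..<b}. \<bar>y k - x k\<bar>)) (at x)"
      using L by simp
    ultimately have "((\<lambda>y. f y - f x) \<longlongrightarrow> 0) (at x)" by (rule Lim_null_comparison[rotated])
    then show ?thesis by (rule LIM_zero_cancel)
  qed
  then show ?thesis by (simp add: continuous_on_def)
qed

lemma borel_measurable_cylinder_Lipschitz:
  "cylinder_Lipschitz a b f \<Longrightarrow> f \<in> borel_measurable borel"
  by (intro borel_measurable_continuous_onI continuous_on_cylinder_Lipschitz)

section \<open>The upper expectation on bounded Lipschitz cylinder functions\<close>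

lemma integrable_borel_probs:
  assumes Q: "Q \<in> borel_probs" and "f \<in> borel_measurable borel" "\<And>x. \<bar>f x\<bar> \<le> B"
  shows "integrable Q (f :: Omega \<Rightarrow> real)"
proof -
  interpret prob_space Q using Q by (simp add: borel_probs_def)
  have [measurable_cong]: "sets Q = sets borel" using Q by (simp add: borel_probs_def)
  show ?thesis using assms
    by (intro integrable_const_bound[of _ B]) (auto simp: measurable_cong_sets[of Q borel])
qed

lemma integrable_cylinder_Lipschitz:
  assumes "Q \<in> borel_probs" "cylinder_Lipschitz a b f"
  shows "integrable Q f"
  using assms integrable_borel_probs borel_measurable_cylinder_Lipschitz
  by (metis cylinder_LipschitzE)

lemma measure_space_borel_probs: "Q \<in> borel_probs \<Longrightarrow> measure Q (space Q) = 1"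
  by (simp add: borel_probs_def prob_space.prob_space)

lemma integral_abs_le_borel_probs:
  assumes Q: "Q \<in> borel_probs" and f: "f \<in> borel_measurable borel" and B: "\<And>x. \<bar>f x\<bar> \<le> B"
  shows "\<bar>integral\<^sup>L Q f\<bar> \<le> (B :: real)"
proof -
  have "\<bar>integral\<^sup>L Q f\<bar> \<le> integral\<^sup>L Q (\<lambda>x. \<bar>f x\<bar>)" by (rule integral_abs_bound)
  also have "\<dots> \<le> integral\<^sup>L Q (\<lambda>_. B)"
    using B integrable_borel_probs[OF Q f B] Q
    by (intro integral_mono integrable_abs integrable_borel_probs[OF Q, of "\<lambda>_. B" "\<bar>B\<bar>"]) auto
  finally show ?thesis using Q by (simp add: measure_space_borel_probs)
qed

lemma Theta_borel_probs: "Q \<in> Theta E \<Longrightarrow> Q \<in> borel_probs"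
  by (simp add: Theta_def)

lemma extended_expectation_upper:
  assumes Q: "Q \<in> Theta E" and f: "cylinder_Lipschitz a b f"
  shows "integral\<^sup>L Q f \<le> extended_expectation E f"
proof -
  obtain B where B: "\<And>x. \<bar>f x\<bar> \<le> B" using cylinder_LipschitzE[OF f] by metis
  have "integral\<^sup>L R f \<le> B" if "R \<in> Theta E" for R
    using integral_abs_le_borel_probs[OF Theta_borel_probs[OF that]
        borel_measurable_cylinder_Lipschitz[OF f] B] by linarith
  then show ?thesis
    unfolding extended_expectation_def using Q by (intro cSUP_upper bdd_aboveI2)
qed

lemma extended_expectation_least:
  assumes "Theta E \<noteq> {}" "\<And>Q. Q \<in> Theta E \<Longrightarrow> integral\<^sup>L Q f \<le> c"
  shows "extended_expectation E f \<le> c"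
  unfolding extended_expectation_def using assms by (rule cSUP_least)

lemma extended_expectation_const:
  assumes "Theta E \<noteq> {}"
  shows "extended_expectation E (\<lambda>_. c) = c"
  unfolding extended_expectation_def using assms
  by (simp add: measure_space_borel_probs Theta_borel_probs cong: SUP_cong_simp)

lemma extended_expectation_abs_le:
  assumes ne: "Theta E \<noteq> {}" and f: "cylinder_Lipschitz a b f" and B: "\<And>x. \<bar>f x\<bar> \<le> B"
  shows "\<bar>extended_expectation E f\<bar> \<le> B"
proof -
  have I: "\<bar>integral\<^sup>L Q f\<bar> \<le> B" if "Q \<in> Theta E" for Q
    using integral_abs_le_borel_probs[OF Theta_borel_probs[OF that]
        borel_measurable_cylinder_Lipschitz[OF f] B] .
  obtain Q where Q: "Q \<in> Theta E" using ne by blast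
  have "extended_expectation E f \<le> B"
    using I by (intro extended_expectation_least[OF ne]) (meson abs_le_D1)
  moreover have "-B \<le> extended_expectation E f"
    using I[OF Q] extended_expectation_upper[OF Q f] by linarith
  ultimately show ?thesis by linarith
qed

text \<open>Subadditivity and monotonicity in one estimate: it makes \<open>extended_expectation E\<close>
  nonexpansive for the sup norm, so Lipschitz bounds survive when a coordinate is integrated out.\<close>

lemma extended_expectation_diff_le:
  assumes ne: "Theta E \<noteq> {}" and f: "cylinder_Lipschitz a b f" and g: "cylinder_Lipschitz a b g"
    and d: "\<And>x. f x - g x \<le> d"
  shows "extended_expectation E f - extended_expectation E g \<le> d"
proof -
  have "integral\<^sup>L Q f \<le> d + extended_expectation E g" if Q: "Q \<in> Theta E" for Q
  proof -
    note int = integrable_cylinder_Lipschitz[OF Theta_borel_probs[OF Q]]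
    have "integral\<^sup>L Q f \<le> integral\<^sup>L Q (\<lambda>x. d + g x)"
      using d int[OF f] int[OF g] int[OF cylinder_Lipschitz_const[of 0 0 d]]
      by (intro integral_mono) (auto simp: algebra_simps)
    also have "\<dots> = d + integral\<^sup>L Q g"
      using int[OF g] int[OF cylinder_Lipschitz_const[of 0 0 d]]
      by (simp add: measure_space_borel_probs[OF Theta_borel_probs[OF Q]])
    also have "\<dots> \<le> d + extended_expectation E g"
      using extended_expectation_upper[OF Q g] by simp
    finally show ?thesis .
  qed
  then have "extended_expectation E f \<le> d + extended_expectation E g"
    by (intro extended_expectation_least[OF ne])
  then show ?thesis by simp
qed

lemma extended_expectation_cmult:
  assumes ne: "Theta E \<noteq> {}" and f: "cylinder_Lipschitz a b f" and c: "0 \<le> c"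
  shows "extended_expectation E (\<lambda>x. f x * c) = extended_expectation E f * c"
proof -
  have le: "extended_expectation E (\<lambda>x. g x * d) \<le> extended_expectation E g * d"
    if "cylinder_Lipschitz a b g" "0 \<le> d" for g d
    using that extended_expectation_upper[OF _ that(1)]
    by (intro extended_expectation_least[OF ne]) (auto intro!: mult_right_mono)
  show ?thesis
  proof (cases "c = 0")
    case True
    then show ?thesis using extended_expectation_const[OF ne, of 0] by simp
  next
    case False
    have "extended_expectation E (\<lambda>x. (f x * c) * inverse c)
        \<le> extended_expectation E (\<lambda>x. f x * c) * inverse c"
      using c by (intro le cylinder_Lipschitz_mult f cylinder_Lipschitz_const) auto
    then have "extended_expectation E f * c \<le> extended_expectation E (\<lambda>x. f x * c)"
      using False c by (simp add: field_simps)
    with le[OF f c] show ?thesis by simp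
  qed
qed

section \<open>Integrating out the first coordinate\<close>

definition integrate_out :: "((Omega \<Rightarrow> real) \<Rightarrow> real) \<Rightarrow> nat \<Rightarrow> (Omega \<Rightarrow> real) \<Rightarrow> Omega \<Rightarrow> real" where
  "integrate_out E i f w = extended_expectation E (\<lambda>w'. f (w(i := w' i)))"

lemma sum_abs_fun_upd:
  fixes x y :: Omega
  shows "(\<Sum>k\<in>{i..<b}. \<bar>(x(i := u)) k - (y(i := u)) k\<bar>) = (\<Sum>k\<in>{Suc i..<b}. \<bar>x k - y k\<bar>)"
  by (rule sum.mono_neutral_cong_right) auto

lemma cylinder_Lipschitz_section:
  assumes "cylinder_Lipschitz i b f"
  shows "cylinder_Lipschitz i (Suc i) (\<lambda>w'. f (w(i := w' i)))"
proof -
  obtain B L where *: "\<And>x. \<bar>f x\<bar> \<le> B" "L \<ge> 0"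
      "\<And>x y. \<bar>f x - f y\<bar> \<le> L * (\<Sum>k\<in>{i..<b}. \<bar>x k - y k\<bar>)"
    using cylinder_LipschitzE[OF assms] by metis
  show ?thesis
  proof (rule cylinder_LipschitzI)
    fix x y :: Omega
    have "\<bar>f (w(i := x i)) - f (w(i := y i))\<bar>
        \<le> L * (\<Sum>k\<in>{i..<b}. \<bar>(w(i := x i)) k - (w(i := y i)) k\<bar>)" by (rule *(3))
    also have "\<dots> = L * (\<Sum>k\<in>{i..<b}. if k = i then \<bar>x i - y i\<bar> else 0)"
      by (intro arg_cong[of _ _ "(*) L"] sum.cong) auto
    also have "\<dots> \<le> L * (\<Sum>k\<in>{i..<Suc i}. \<bar>x k - y k\<bar>)"
      using *(2) by (intro mult_left_mono) auto
    finally show "\<bar>f (w(i := x i)) - f (w(i := y i))\<bar> \<le> L * (\<Sum>k\<in>{i..<Suc i}. \<bar>x k - y k\<bar>)" .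
  qed (use * in auto)
qed

lemma cylinder_Lipschitz_integrate_out:
  assumes ne: "Theta E \<noteq> {}" and f: "cylinder_Lipschitz i b f"
  shows "cylinder_Lipschitz (Suc i) b (integrate_out E i f)"
proof -
  obtain B L where *: "\<And>x. \<bar>f x\<bar> \<le> B" "L \<ge> 0"
      "\<And>x y. \<bar>f x - f y\<bar> \<le> L * (\<Sum>k\<in>{i..<b}. \<bar>x k - y k\<bar>)"
    using cylinder_LipschitzE[OF f] by metis
  have one_sided: "integrate_out E i f x - integrate_out E i f y
      \<le> L * (\<Sum>k\<in>{Suc i..<b}. \<bar>x k - y k\<bar>)" for x y
    unfolding integrate_out_def
  proof (rule extended_expectation_diff_le[OF ne cylinder_Lipschitz_section[OF f]
        cylinder_Lipschitz_section[OF f]])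
    show "f (x(i := z i)) - f (y(i := z i)) \<le> L * (\<Sum>k\<in>{Suc i..<b}. \<bar>x k - y k\<bar>)" for z :: Omega
      using *(3)[of "x(i := z i)" "y(i := z i)"] unfolding sum_abs_fun_upd by linarith
  qed
  show ?thesis
  proof (rule cylinder_LipschitzI)
    show "\<bar>integrate_out E i f x\<bar> \<le> B" for x
      unfolding integrate_out_def
      by (rule extended_expectation_abs_le[OF ne cylinder_Lipschitz_section[OF f] *(1)])
    show "\<bar>integrate_out E i f x - integrate_out E i f y\<bar>
      \<le> L * (\<Sum>k\<in>{Suc i..<b}. \<bar>x k - y k\<bar>)" for x y
      using one_sided[of x y] one_sided[of y x] by (simp add: abs_le_iff abs_minus_commute)
  qed (rule *(2))
qed

text \<open>This is the independence of coordinate \<open>i\<close> from the later coordinates, transported from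
  functions on lists to functions on \<open>\<Omega>\<close>.\<close>

lemma extended_expectation_integrate_out:
  assumes iid: "backward_iid (extended_expectation E) xi" and f: "cylinder_Lipschitz i b f"
  shows "extended_expectation E f = extended_expectation E (integrate_out E i f)"
proof -
  \<comment> \<open>Independence concerns at least one later coordinate, so the window is enlarged if \<open>b\<close> is too
    small.  In the list the integrated coordinate \<open>i\<close> stands last, at position \<open>n\<close>.\<close>
  define n where "n = max 1 (b - i - 1)"
  define F where "F l = f (\<lambda>k. if k = i then l ! n
      else if i < k \<and> k \<le> i + n then l ! (k - i - 1) else 0)" for l :: "real list"
  have f': "cylinder_Lipschitz i (i + n + 1) f"
    using f by (rule cylinder_Lipschitz_mono) (auto simp: n_def)
  obtain B L where *: "\<And>x. \<bar>f x\<bar> \<le> B" "L \<ge> 0"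
      "\<And>x y. \<bar>f x - f y\<bar> \<le> L * (\<Sum>k\<in>{i..<i + n + 1}. \<bar>x k - y k\<bar>)"
    using cylinder_LipschitzE[OF f'] by metis
  have "F \<in> bounded_Lipschitz (n + 1)"
  proof -
    have "\<bar>F x - F y\<bar> \<le> (L * real (n + 1)) * L2_set (\<lambda>m. x ! m - y ! m) {..<n + 1}" for x y
    proof -
      have coord: "\<bar>x ! m - y ! m\<bar> \<le> L2_set (\<lambda>m. x ! m - y ! m) {..<n + 1}" if "m < n + 1" for m
        using member_le_L2_set[of "{..<n + 1}" m "\<lambda>m. \<bar>x ! m - y ! m\<bar>"] that
        by (simp add: L2_set_def)
      have "\<bar>F x - F y\<bar> \<le> L * (\<Sum>k\<in>{i..<i + n + 1}. L2_set (\<lambda>m. x ! m - y ! m) {..<n + 1})"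
        unfolding F_def using *(2)
        by (intro order_trans[OF *(3)] mult_left_mono sum_mono) (auto intro!: coord simp del: One_nat_def)
      then show ?thesis by simp
    qed
    then show ?thesis unfolding bounded_Lipschitz_def using *(1) by (auto simp: F_def)
  qed
  moreover have "independent_of (extended_expectation E) 1 (\<lambda>w. [xi i w]) n
      (\<lambda>w. map (\<lambda>k. xi k w) [i + 1..<i + n + 1])"
    using iid unfolding backward_iid_def by (auto simp: n_def)
  ultimately have "extended_expectation E (\<lambda>w. F (map (\<lambda>k. xi k w) [i + 1..<i + n + 1] @ [xi i w]))
      = extended_expectation E (\<lambda>w. extended_expectation E
          (\<lambda>w'. F (map (\<lambda>k. xi k w) [i + 1..<i + n + 1] @ [xi i w'])))"
    unfolding independent_of_def by (rule bspec[rotated])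
  moreover have F_eq: "F (map (\<lambda>k. xi k w) [i + 1..<i + n + 1] @ [xi i w']) = f (w(i := w' i))"
    for w w'
    unfolding F_def
    by (rule cylinder_Lipschitz_cong[OF f']) (auto simp: nth_append xi_def simp del: upt_Suc)
  moreover have "integrate_out E i f = (\<lambda>w. extended_expectation E (\<lambda>w'. f (w(i := w' i))))"
    by (simp add: integrate_out_def fun_eq_iff)
  ultimately show ?thesis by (simp only: F_eq fun_upd_triv)
qed

text \<open>The heart of the proof.  The factor \<open>g\<close> depends only on coordinates that are fixed while
  coordinate \<open>i < n\<close> is integrated out, hence positive homogeneity pulls it out of each of
  these integrations.  The same integrations applied to \<open>f\<close> alone lead to the number
  \<open>extended_expectation E f\<close>.  The sign of \<open>g\<close> matters, since \<open>extended_expectation E\<close>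
  is not homogeneous for negative factors.\<close>

lemma extended_expectation_mult_later:
  assumes ne: "Theta E \<noteq> {}" and iid: "backward_iid (extended_expectation E) xi"
    and f: "cylinder_Lipschitz i n f" and g: "cylinder_Lipschitz n m g" "\<And>x. 0 \<le> g x"
    and "i \<le> n"
  shows "extended_expectation E (\<lambda>w. f w * g w)
       = extended_expectation E (\<lambda>w. extended_expectation E f * g w)"
  using \<open>i \<le> n\<close> f
proof (induction i arbitrary: f rule: inc_induct)
  case base
  \<comment> \<open>The window of \<open>f\<close> is empty, so \<open>f\<close> is a constant.\<close>
  have "f w = f (\<lambda>_. 0)" for w
    by (rule cylinder_Lipschitz_cong[OF base]) auto
  then have "f = (\<lambda>_. f (\<lambda>_. 0))" by blast
  then have "extended_expectation E f = f (\<lambda>_. 0)" and "f = (\<lambda>_. f (\<lambda>_. 0))"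
    using extended_expectation_const[OF ne] by metis+
  then show ?case by metis
next
  case (step i)
  have fg: "cylinder_Lipschitz i (max n m) (\<lambda>w. f w * g w)"
    using step.hyps
    by (intro cylinder_Lipschitz_mult cylinder_Lipschitz_mono[OF step.prems]
        cylinder_Lipschitz_mono[OF g(1)]) auto
  have g_upd: "g (w(i := u)) = g w" for w u
    using step.hyps by (intro cylinder_Lipschitz_cong[OF g(1)]) auto
  have "integrate_out E i (\<lambda>w. f w * g w) = (\<lambda>w. integrate_out E i f w * g w)"
    unfolding integrate_out_def g_upd
    by (intro ext extended_expectation_cmult[OF ne cylinder_Lipschitz_section[OF step.prems]] g(2))
  then have "extended_expectation E (\<lambda>w. f w * g w)
      = extended_expectation E (\<lambda>w. integrate_out E i f w * g w)"
    using extended_expectation_integrate_out[OF iid fg] by simp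
  also have "\<dots> = extended_expectation E (\<lambda>w. extended_expectation E (integrate_out E i f) * g w)"
    by (intro step.IH cylinder_Lipschitz_integrate_out[OF ne step.prems])
  also have "extended_expectation E (integrate_out E i f) = extended_expectation E f"
    using extended_expectation_integrate_out[OF iid step.prems] by simp
  finally show ?case .
qed

text \<open>The centred function \<open>f - extended_expectation E f\<close> has upper expectation at most zero.
  By the factorization above, multiplying it by a nonnegative later factor keeps it so, and
  \<open>P\<close> is dominated by the upper expectation.\<close>

lemma integral_mult_later_le:
  assumes iid: "backward_iid (extended_expectation E) xi" and P: "P \<in> Theta E"
    and f: "cylinder_Lipschitz 0 n f" and g: "cylinder_Lipschitz n m g" "\<And>x. 0 \<le> g x"
  shows "integral\<^sup>L P (\<lambda>\<omega>. (f \<omega> - extended_expectation E f) * g \<omega>) \<le> 0"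
proof -
  let ?c = "extended_expectation E f"
  have ne: "Theta E \<noteq> {}" using P by blast
  have h: "cylinder_Lipschitz 0 n (\<lambda>\<omega>. f \<omega> - ?c)"
    by (intro cylinder_Lipschitz_diff f cylinder_Lipschitz_const)
  have "extended_expectation E (\<lambda>\<omega>. f \<omega> - ?c) \<le> 0"
    using extended_expectation_upper[OF _ f] integrable_cylinder_Lipschitz[OF Theta_borel_probs f]
      integrable_cylinder_Lipschitz[OF Theta_borel_probs cylinder_Lipschitz_const]
    by (intro extended_expectation_least[OF ne])
       (simp add: measure_space_borel_probs Theta_borel_probs)
  then have c0: "extended_expectation E (\<lambda>\<omega>. f \<omega> - ?c) * g \<omega> \<le> 0" for \<omega>
    using g(2) by (rule mult_nonpos_nonneg)
  have "cylinder_Lipschitz 0 (max n m) (\<lambda>\<omega>. (f \<omega> - ?c) * g \<omega>)"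
    by (intro cylinder_Lipschitz_mult cylinder_Lipschitz_mono[OF h]
        cylinder_Lipschitz_mono[OF g(1)]) auto
  with P have "integral\<^sup>L P (\<lambda>\<omega>. (f \<omega> - ?c) * g \<omega>)
      \<le> extended_expectation E (\<lambda>\<omega>. (f \<omega> - ?c) * g \<omega>)"
    by (rule extended_expectation_upper)
  also have "\<dots> = extended_expectation E (\<lambda>\<omega>. extended_expectation E (\<lambda>\<omega>. f \<omega> - ?c) * g \<omega>)"
    by (rule extended_expectation_mult_later[OF ne iid h g]) simp
  also have "\<dots> \<le> 0"
  proof (rule extended_expectation_least[OF ne])
    fix Q
    have "0 \<le> integral\<^sup>L Q (\<lambda>\<omega>. - (extended_expectation E (\<lambda>\<omega>. f \<omega> - ?c) * g \<omega>))"
      using c0 by (intro Bochner_Integration.integral_nonneg) simp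
    then show "integral\<^sup>L Q (\<lambda>\<omega>. extended_expectation E (\<lambda>\<omega>. f \<omega> - ?c) * g \<omega>) \<le> 0"
      by simp
  qed
  finally show ?thesis .
qed

section \<open>Approximating events of the later coordinates\<close>

definition L1_approximable :: "Omega measure \<Rightarrow> nat \<Rightarrow> Omega set \<Rightarrow> bool" where
  "L1_approximable P n A \<longleftrightarrow> A \<in> sets borel \<and> (\<forall>\<epsilon>>0. \<exists>g m. cylinder_Lipschitz n m g \<and>
     (\<forall>x. 0 \<le> g x \<and> g x \<le> 1) \<and> integral\<^sup>L P (\<lambda>x. \<bar>indicator A x - g x\<bar>) < \<epsilon>)"

lemma L1_approximableE:
  assumes "L1_approximable P n A" "0 < \<epsilon>"
  obtains g m where "cylinder_Lipschitz n m g" "\<And>x. 0 \<le> g x" "\<And>x. g x \<le> 1"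
    "integral\<^sup>L P (\<lambda>x. \<bar>indicator A x - g x\<bar>) < \<epsilon>"
  using assms unfolding L1_approximable_def by metis

lemma integrable_indicator_diff:
  assumes P: "P \<in> borel_probs" and g: "g \<in> borel_measurable borel" "\<And>x. 0 \<le> g x" "\<And>x. g x \<le> 1"
    and "A \<in> sets borel"
  shows "integrable P (\<lambda>x. \<bar>indicator A x - g x\<bar> :: real)"
  using assms by (intro integrable_borel_probs[OF P, of _ 1]) (auto simp: indicator_def)

lemma L1_approximable_empty: "L1_approximable P n {}"
  unfolding L1_approximable_def
  by (auto intro!: exI[of _ "\<lambda>_. 0"] cylinder_Lipschitz_const)

lemma L1_approximable_Compl:
  assumes "L1_approximable P n A"
  shows "L1_approximable P n (UNIV - A)"
  unfolding L1_approximable_def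
proof safe
  show "UNIV - A \<in> sets borel"
    using assms unfolding L1_approximable_def by (metis Compl_eq_Diff_UNIV borel_comp)
  fix \<epsilon> :: real assume "0 < \<epsilon>"
  obtain g m where g: "cylinder_Lipschitz n m g" "\<And>x. 0 \<le> g x" "\<And>x. g x \<le> 1"
      "integral\<^sup>L P (\<lambda>x. \<bar>indicator A x - g x\<bar>) < \<epsilon>"
    by (rule L1_approximableE[OF assms \<open>0 < \<epsilon>\<close>]) (rule that; assumption)
  have "\<bar>indicator (UNIV - A) x - (1 - g x)\<bar> = \<bar>indicator A x - g x\<bar>" for x
    by (auto simp: indicator_def)
  with g show "\<exists>g m. cylinder_Lipschitz n m g \<and> (\<forall>x. 0 \<le> g x \<and> g x \<le> 1) \<and>
      integral\<^sup>L P (\<lambda>x. \<bar>indicator (UNIV - A) x - g x\<bar>) < \<epsilon>"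
    by (intro exI[of _ "\<lambda>x. 1 - g x"] exI[of _ m] conjI cylinder_Lipschitz_diff
        cylinder_Lipschitz_const) auto
qed

lemma L1_approximable_Un:
  assumes P: "P \<in> borel_probs" and A: "L1_approximable P n A" and B: "L1_approximable P n B"
  shows "L1_approximable P n (A \<union> B)"
  unfolding L1_approximable_def
proof (intro conjI allI impI)
  have AB: "A \<in> sets borel" "B \<in> sets borel" using A B by (simp_all add: L1_approximable_def)
  then show "A \<union> B \<in> sets borel" by simp
  fix \<epsilon> :: real assume "0 < \<epsilon>"
  then have e2: "0 < \<epsilon> / 2" by simp
  obtain g m where g: "cylinder_Lipschitz n m g" "\<And>x. 0 \<le> g x" "\<And>x. g x \<le> 1"
      "integral\<^sup>L P (\<lambda>x. \<bar>indicator A x - g x\<bar>) < \<epsilon> / 2"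
    by (rule L1_approximableE[OF A e2]) (rule that; assumption)
  obtain h m' where h: "cylinder_Lipschitz n m' h" "\<And>x. 0 \<le> h x" "\<And>x. h x \<le> 1"
      "integral\<^sup>L P (\<lambda>x. \<bar>indicator B x - h x\<bar>) < \<epsilon> / 2"
    by (rule L1_approximableE[OF B e2]) (rule that; assumption)
  let ?k = "\<lambda>x. max (g x) (h x)"
  have k: "cylinder_Lipschitz n (max m m') ?k"
    by (intro cylinder_Lipschitz_max cylinder_Lipschitz_mono[OF g(1)]
        cylinder_Lipschitz_mono[OF h(1)]) auto
  have k01: "0 \<le> ?k x" "?k x \<le> 1" for x using g(2,3)[of x] h(2,3)[of x] by auto
  note meas = borel_measurable_cylinder_Lipschitz
  have "integral\<^sup>L P (\<lambda>x. \<bar>indicator (A \<union> B) x - ?k x\<bar>)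
      \<le> integral\<^sup>L P (\<lambda>x. \<bar>indicator A x - g x\<bar> + \<bar>indicator B x - h x\<bar>)"
  proof (intro integral_mono integrable_indicator_diff[OF P] Bochner_Integration.integrable_add)
    show "\<bar>indicator (A \<union> B) x - ?k x\<bar> \<le> \<bar>indicator A x - g x\<bar> + \<bar>indicator B x - h x\<bar>" for x
      using g(2,3)[of x] h(2,3)[of x] by (cases "x \<in> A"; cases "x \<in> B") auto
  qed (use AB meas[OF g(1)] meas[OF h(1)] meas[OF k] g h k01 in auto)
  also have "\<dots> = integral\<^sup>L P (\<lambda>x. \<bar>indicator A x - g x\<bar>) + integral\<^sup>L P (\<lambda>x. \<bar>indicator B x - h x\<bar>)"
    using AB meas[OF g(1)] meas[OF h(1)] g h
    by (intro Bochner_Integration.integral_add integrable_indicator_diff[OF P]) auto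
  also have "\<dots> < \<epsilon>" using g(4) h(4) by simp
  finally show "\<exists>g m. cylinder_Lipschitz n m g \<and> (\<forall>x. 0 \<le> g x \<and> g x \<le> 1) \<and>
      integral\<^sup>L P (\<lambda>x. \<bar>indicator (A \<union> B) x - g x\<bar>) < \<epsilon>"
    using k k01 by (intro exI[of _ ?k] exI[of _ "max m m'"]) simp
qed

lemma L1_approximable_limit:
  assumes P: "P \<in> borel_probs" and A: "A \<in> sets borel"
    and g: "\<And>j. cylinder_Lipschitz n (m j) (g j)" "\<And>j x. 0 \<le> g j x" "\<And>j x. g j x \<le> 1"
    and lim: "\<And>x. (\<lambda>j. g j x) \<longlonglongrightarrow> indicator A x"
  shows "L1_approximable P n A"
  unfolding L1_approximable_def
proof (intro conjI allI impI A)
  interpret prob_space P using P by (simp add: borel_probs_def)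
  have [measurable_cong]: "sets P = sets borel" using P by (simp add: borel_probs_def)
  have [measurable]: "g j \<in> borel_measurable borel" for j
    by (rule borel_measurable_cylinder_Lipschitz[OF g(1)])
  note A[measurable]
  have "(\<lambda>j. integral\<^sup>L P (\<lambda>x. \<bar>indicator A x - g j x\<bar>)) \<longlonglongrightarrow> integral\<^sup>L P (\<lambda>x. 0 :: real)"
  proof (rule integral_dominated_convergence[of _ _ _ "\<lambda>_. 1"])
    have "(\<lambda>j. \<bar>indicator A x - g j x\<bar>) \<longlonglongrightarrow> \<bar>indicator A x - indicator A x\<bar>" for x
      by (intro tendsto_intros lim)
    then show "AE x in P. (\<lambda>j. \<bar>indicator A x - g j x\<bar>) \<longlonglongrightarrow> 0" by simp
    show "AE x in P. norm \<bar>indicator A x - g j x\<bar> \<le> 1" for j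
      using g(2,3) by (auto simp: indicator_def)
  qed simp_all
  moreover fix \<epsilon> :: real assume "0 < \<epsilon>"
  ultimately have "eventually (\<lambda>j. integral\<^sup>L P (\<lambda>x. \<bar>indicator A x - g j x\<bar>) < \<epsilon>) sequentially"
    by (intro order_tendstoD) simp_all
  then obtain j where "integral\<^sup>L P (\<lambda>x. \<bar>indicator A x - g j x\<bar>) < \<epsilon>"
    unfolding eventually_sequentially by blast
  then show "\<exists>g m. cylinder_Lipschitz n m g \<and> (\<forall>x. 0 \<le> g x \<and> g x \<le> 1) \<and>
      integral\<^sup>L P (\<lambda>x. \<bar>indicator A x - g x\<bar>) < \<epsilon>"
    using g by (intro exI[of _ "g j"] exI[of _ "m j"]) simp
qed

text \<open>By continuity of \<open>P\<close> along increasing unions, finitely many of the sets exhaust the union up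
  to \<open>\<epsilon> / 2\<close>; finite unions are handled by maxima of the approximants.\<close>

lemma L1_approximable_UN:
  assumes P: "P \<in> borel_probs" and A: "\<And>j :: nat. L1_approximable P n (A j)"
  shows "L1_approximable P n (\<Union>j. A j)"
  unfolding L1_approximable_def
proof (intro conjI allI impI)
  interpret prob_space P using P by (simp add: borel_probs_def)
  have [simp, measurable_cong]: "sets P = sets borel" using P by (simp add: borel_probs_def)
  have [measurable]: "A j \<in> sets borel" for j using A by (simp add: L1_approximable_def)
  show "(\<Union>j. A j) \<in> sets borel" by measurable
  let ?U = "\<lambda>N. \<Union>j<N. A j"
  have U: "L1_approximable P n (?U N)" for N
    by (induction N) (simp_all add: L1_approximable_empty lessThan_Suc L1_approximable_Un[OF P A])
  have "(\<lambda>N. prob (?U N)) \<longlonglongrightarrow> prob (\<Union>N. ?U N)"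
    by (intro finite_Lim_measure_incseq monoI UN_mono) auto
  moreover have "(\<Union>N. ?U N) = (\<Union>j. A j)" by auto
  ultimately have lim: "(\<lambda>N. prob (?U N)) \<longlonglongrightarrow> prob (\<Union>j. A j)" by simp
  fix \<epsilon> :: real assume "0 < \<epsilon>"
  then have "eventually (\<lambda>N. prob (\<Union>j. A j) - \<epsilon> / 2 < prob (?U N)) sequentially"
    by (intro order_tendstoD(1)[OF lim]) simp
  then obtain N where N: "prob (\<Union>j. A j) - \<epsilon> / 2 < prob (?U N)"
    unfolding eventually_sequentially by blast
  have e2: "0 < \<epsilon> / 2" using \<open>0 < \<epsilon>\<close> by simp
  obtain g m where g: "cylinder_Lipschitz n m g" "\<And>x. 0 \<le> g x" "\<And>x. g x \<le> 1"
      "integral\<^sup>L P (\<lambda>x. \<bar>indicator (?U N) x - g x\<bar>) < \<epsilon> / 2"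
    by (rule L1_approximableE[OF U e2]) (rule that; assumption)
  note [measurable] = borel_measurable_cylinder_Lipschitz[OF g(1)]
  let ?D = "(\<Union>j. A j) - ?U N"
  have int_D: "integrable P (indicator ?D :: Omega \<Rightarrow> real)"
    by (intro integrable_borel_probs[OF P, of _ 1]) (auto simp: indicator_def)
  have int_U: "integrable P (\<lambda>x. \<bar>indicator (?U N) x - g x\<bar>)"
    using g by (intro integrable_indicator_diff[OF P]) auto
  have "integral\<^sup>L P (\<lambda>x. \<bar>indicator (\<Union>j. A j) x - g x\<bar>)
      \<le> integral\<^sup>L P (\<lambda>x. indicator ?D x + \<bar>indicator (?U N) x - g x\<bar>)"
  proof (intro integral_mono Bochner_Integration.integrable_add int_D int_U)
    show "integrable P (\<lambda>x. \<bar>indicator (\<Union>j. A j) x - g x\<bar>)"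
      using g by (intro integrable_indicator_diff[OF P]) auto
    show "\<bar>indicator (\<Union>j. A j) x - g x\<bar> \<le> indicator ?D x + \<bar>indicator (?U N) x - g x\<bar>" for x
      using g(2,3)[of x] by (cases "x \<in> (\<Union>j. A j)"; cases "x \<in> ?U N") auto
  qed
  also have "\<dots> = prob ?D + integral\<^sup>L P (\<lambda>x. \<bar>indicator (?U N) x - g x\<bar>)"
    using int_D int_U by (subst Bochner_Integration.integral_add) simp_all
  also have "prob ?D = prob (\<Union>j. A j) - prob (?U N)"
    by (intro finite_measure_Diff) auto
  finally have "integral\<^sup>L P (\<lambda>x. \<bar>indicator (\<Union>j. A j) x - g x\<bar>) < \<epsilon>" using N g(4) by linarith
  with g show "\<exists>g m. cylinder_Lipschitz n m g \<and> (\<forall>x. 0 \<le> g x \<and> g x \<le> 1) \<and>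
      integral\<^sup>L P (\<lambda>x. \<bar>indicator (\<Union>j. A j) x - g x\<bar>) < \<epsilon>"
    by (intro exI[of _ g] exI[of _ m]) simp
qed

lemma measurable_xi: "xi k \<in> borel_measurable borel"
  unfolding xi_def[abs_def]
  by (intro borel_measurable_continuous_onI continuous_on_product_coordinates)

text \<open>The indicator of an open half-line is the limit of piecewise linear ramps of slope
  \<open>-j\<close>.\<close>

lemma L1_approximable_half_space:
  assumes P: "P \<in> borel_probs" and "n \<le> k"
  shows "L1_approximable P n (xi k -` {..<a})"
proof (rule L1_approximable_limit[OF P])
  let ?g = "\<lambda>j x. max 0 (min 1 (real j * (a - x k)))"
  show "xi k -` {..<a} \<in> sets borel"
    using measurable_sets[OF measurable_xi, of "{..<a}"] by simp
  show "cylinder_Lipschitz n (Suc k) (?g j)" for j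
  proof (rule cylinder_LipschitzI[of _ 1 "real j"])
    fix x y :: Omega
    have "\<bar>?g j x - ?g j y\<bar> \<le> \<bar>real j * (a - x k) - real j * (a - y k)\<bar>" by linarith
    also have "\<dots> = real j * \<bar>x k - y k\<bar>"
      by (simp flip: right_diff_distrib add: abs_mult abs_minus_commute)
    also have "\<dots> \<le> real j * (\<Sum>k\<in>{n..<Suc k}. \<bar>x k - y k\<bar>)"
      using \<open>n \<le> k\<close> by (intro mult_left_mono member_le_sum) auto
    finally show "\<bar>?g j x - ?g j y\<bar> \<le> real j * (\<Sum>k\<in>{n..<Suc k}. \<bar>x k - y k\<bar>)" .
  qed auto
  show "0 \<le> ?g j x" "?g j x \<le> 1" for j x by auto
  show "(\<lambda>j. ?g j x) \<longlonglongrightarrow> indicator (xi k -` {..<a}) x" for x :: Omega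
  proof (cases "x k < a")
    case True
    obtain J :: nat where J: "1 / (a - x k) \<le> real J" using real_arch_simple by blast
    have "?g j x = 1" if "J \<le> j" for j
    proof -
      have "1 / (a - x k) \<le> real j" using J that by linarith
      then have "1 \<le> real j * (a - x k)" using True by (simp add: field_simps)
      then show ?thesis by simp
    qed
    then have "eventually (\<lambda>j. ?g j x = 1) sequentially"
      unfolding eventually_sequentially by blast
    then show ?thesis using True by (simp add: xi_def tendsto_eventually)
  next
    case False
    then have "real j * (a - x k) \<le> 0" for j by (simp add: mult_nonneg_nonpos)
    then have "?g j x = 0" for j by (metis max.absorb1 min.coboundedI2)
    then show ?thesis using False by (simp add: xi_def)
  qed
qed

text \<open>Approximability is stable under the \<open>\<sigma>\<close>-algebra operations, so it spreads from half-lines to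
  all Borel conditions on one coordinate, and from these to the whole \<open>\<sigma>\<close>-algebra of the later
  coordinates.\<close>

lemma L1_approximable_tail_from:
  assumes P: "P \<in> borel_probs" and "A \<in> tail_from n"
  shows "L1_approximable P n A"
  using assms(2) unfolding tail_from_def
proof (induction rule: sigma_sets.induct)
  case (Basic A)
  then obtain k B where k: "n \<le> k" and A: "A = xi k -` B" and B: "B \<in> sets borel" by auto
  have "B \<in> sigma_sets UNIV (range lessThan)"
    using B by (subst (asm) borel_Iio) simp
  then have "L1_approximable P n (xi k -` B)"
  proof (induction rule: sigma_sets.induct)
    case (Basic B)
    then show ?case using L1_approximable_half_space[OF P k] by auto
  next
    case (Compl B)
    then show ?case using L1_approximable_Compl by (simp add: vimage_Diff)
  next
    case (Union B)
    then show ?case using L1_approximable_UN[OF P] by (simp add: vimage_UN)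
  qed (simp add: L1_approximable_empty)
  then show ?case using A by simp
qed (auto intro: L1_approximable_empty L1_approximable_Compl L1_approximable_UN[OF P])

lemma tail_algebra_sets_borel: "A \<in> tail_algebra \<Longrightarrow> A \<in> sets borel"
proof -
  assume "A \<in> tail_algebra"
  then have "A \<in> tail_from 0" by (simp add: tail_algebra_def)
  moreover have "xi k -` B \<in> sets borel" if "B \<in> sets borel" for k B
    using measurable_sets[OF measurable_xi that] by simp
  then have gen: "(\<Union>k\<in>{0..}. {xi k -` B | B. B \<in> sets borel}) \<subseteq> sets borel" by blast
  have "tail_from 0 \<subseteq> sets borel"
    using sets.sigma_sets_subset[OF gen] by (simp only: tail_from_def space_borel)
  ultimately show ?thesis by blast
qed

lemma tail_algebra_Compl:
  assumes "A \<in> tail_algebra" shows "- A \<in> tail_algebra"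
proof -
  have "UNIV - A \<in> tail_from n" for n
  proof -
    have "A \<in> tail_from n" using assms by (simp add: tail_algebra_def)
    then show ?thesis unfolding tail_from_def by (rule sigma_sets.Compl)
  qed
  then show ?thesis by (simp add: tail_algebra_def Compl_eq_Diff_UNIV)
qed

text \<open>The error made by replacing the indicator by a Lipschitz approximant is at most the sup norm
  of the centred function times the \<open>L\<^sup>1\<close>-distance.\<close>

lemma integral_indicator_later_le:
  assumes iid: "backward_iid (extended_expectation E) xi" and P: "P \<in> Theta E"
    and f: "cylinder_Lipschitz 0 n f" and A: "A \<in> tail_from n"
  shows "integral\<^sup>L P (\<lambda>\<omega>. (f \<omega> - extended_expectation E f) * indicator A \<omega>) \<le> 0"
proof (rule field_le_epsilon)
  let ?h = "\<lambda>\<omega>. f \<omega> - extended_expectation E f"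
  note bp = Theta_borel_probs[OF P]
  have h: "cylinder_Lipschitz 0 n ?h"
    by (intro cylinder_Lipschitz_diff f cylinder_Lipschitz_const)
  obtain B where B: "\<And>x. \<bar>?h x\<bar> \<le> B" "0 \<le> B" using cylinder_LipschitzE[OF h] by metis
  have appr: "L1_approximable P n A" by (rule L1_approximable_tail_from[OF bp A])
  then have [measurable]: "A \<in> sets borel" by (simp add: L1_approximable_def)
  fix \<epsilon> :: real assume "0 < \<epsilon>"
  then have eB: "0 < \<epsilon> / (B + 1)" using B by simp
  obtain g m where g: "cylinder_Lipschitz n m g" "\<And>x. 0 \<le> g x" "\<And>x. g x \<le> 1"
      "integral\<^sup>L P (\<lambda>x. \<bar>indicator A x - g x\<bar>) < \<epsilon> / (B + 1)"
    by (rule L1_approximableE[OF appr eB]) (rule that; assumption)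
  note [measurable] = borel_measurable_cylinder_Lipschitz[OF g(1)]
    borel_measurable_cylinder_Lipschitz[OF h]
  have int_g: "integrable P (\<lambda>x. ?h x * g x)"
    using g(2,3) B by (intro integrable_borel_probs[OF bp, of _ "B * 1"])
      (auto simp: abs_mult intro!: mult_mono[of _ B _ 1, simplified])
  have int_d: "integrable P (\<lambda>x. B * \<bar>indicator A x - g x\<bar>)"
    by (intro integrable_mult_right integrable_indicator_diff[OF bp] g) auto
  have "integral\<^sup>L P (\<lambda>x. ?h x * indicator A x)
      \<le> integral\<^sup>L P (\<lambda>x. ?h x * g x + B * \<bar>indicator A x - g x\<bar>)"
  proof (intro integral_mono Bochner_Integration.integrable_add int_g int_d)
    show "integrable P (\<lambda>x. ?h x * indicator A x)"
      using B by (intro integrable_borel_probs[OF bp, of _ B]) (auto simp: indicator_def)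
    fix x
    have "?h x * (indicator A x - g x) \<le> \<bar>?h x\<bar> * \<bar>indicator A x - g x\<bar>"
      by (metis abs_ge_self abs_mult)
    also have "\<dots> \<le> B * \<bar>indicator A x - g x\<bar>" by (intro mult_right_mono B) simp
    finally show "?h x * indicator A x \<le> ?h x * g x + B * \<bar>indicator A x - g x\<bar>"
      by (simp add: algebra_simps)
  qed
  also have "\<dots> = integral\<^sup>L P (\<lambda>x. ?h x * g x) + B * integral\<^sup>L P (\<lambda>x. \<bar>indicator A x - g x\<bar>)"
    using int_g int_d by simp
  also have "\<dots> \<le> 0 + (B + 1) * (\<epsilon> / (B + 1))"
    using g(4) B eB
    by (intro add_mono mult_mono integral_mult_later_le[OF iid P f g(1,2)]) auto
  also have "\<dots> = 0 + \<epsilon>" using B by simp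
  finally show "integral\<^sup>L P (\<lambda>x. ?h x * indicator A x) \<le> 0 + \<epsilon>" .
qed

section \<open>Lipschitz minorants of continuous functions\<close>

lemma tendsto_Omega_iff:
  fixes w :: "nat \<Rightarrow> Omega"
  shows "w \<longlonglongrightarrow> x \<longleftrightarrow> (\<forall>k. (\<lambda>n. w n k) \<longlonglongrightarrow> x k)"
  using limitin_componentwise[of "\<lambda>_::nat. euclidean :: real topology" UNIV w x sequentially]
  by (simp add: euclidean_product_topology)

text \<open>The inf-convolution of \<open>X\<close> with \<open>n\<close> times the \<open>\<ell>\<^sup>1\<close>-distance of the first \<open>n\<close>
  coordinates.  Both the slope and the number of coordinates grow, so that in the limit a
  near-minimizer is forced to agree with \<open>\<omega>\<close> in every coordinate.\<close>

definition Lipschitz_minorant :: "(Omega \<Rightarrow> real) \<Rightarrow> nat \<Rightarrow> Omega \<Rightarrow> real" where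
  "Lipschitz_minorant X n \<omega> = (INF \<omega>'. X \<omega>' + real n * (\<Sum>k\<in>{0..<n}. \<bar>\<omega> k - \<omega>' k\<bar>))"

lemma bdd_below_Lipschitz_minorant:
  fixes X :: "Omega \<Rightarrow> real"
  assumes "\<And>x. \<bar>X x\<bar> \<le> M"
  shows "bdd_below (range (\<lambda>\<omega>'. X \<omega>' + real n * (\<Sum>k\<in>{0..<n}. \<bar>\<omega> k - \<omega>' k\<bar>)))"
proof (rule bdd_belowI2[of _ "-M"])
  fix \<omega>'
  have "0 \<le> real n * (\<Sum>k\<in>{0..<n}. \<bar>\<omega> k - \<omega>' k\<bar>)" by (simp add: sum_nonneg)
  then show "- M \<le> X \<omega>' + real n * (\<Sum>k\<in>{0..<n}. \<bar>\<omega> k - \<omega>' k\<bar>)"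
    using assms[of \<omega>'] by linarith
qed

lemma Lipschitz_minorant_le:
  assumes "\<And>x. \<bar>X x\<bar> \<le> M"
  shows "Lipschitz_minorant X n \<omega> \<le> X \<omega>'  + real n * (\<Sum>k\<in>{0..<n}. \<bar>\<omega> k - \<omega>' k\<bar>)"
  unfolding Lipschitz_minorant_def
  by (rule cINF_lower[OF bdd_below_Lipschitz_minorant[of X M, OF assms]]) simp

lemma Lipschitz_minorant_le_self:
  assumes "\<And>x. \<bar>X x\<bar> \<le> M"
  shows "Lipschitz_minorant X n \<omega> \<le> X \<omega>"
  using Lipschitz_minorant_le[of X M, OF assms, of n \<omega> \<omega>] by simp

lemma Lipschitz_minorant_ge:
  assumes M: "\<And>x. \<bar>X x\<bar> \<le> M"
  shows "- M \<le> Lipschitz_minorant X n \<omega>"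
  unfolding Lipschitz_minorant_def
proof (rule cINF_greatest)
  fix \<omega>'
  have "0 \<le> real n * (\<Sum>k\<in>{0..<n}. \<bar>\<omega> k - \<omega>' k\<bar>)" by (simp add: sum_nonneg)
  then show "- M \<le> X \<omega>' + real n * (\<Sum>k\<in>{0..<n}. \<bar>\<omega> k - \<omega>' k\<bar>)"
    using M[of \<omega>'] by linarith
qed simp

lemma cylinder_Lipschitz_minorant:
  assumes M: "\<And>x. \<bar>X x\<bar> \<le> M"
  shows "cylinder_Lipschitz 0 n (Lipschitz_minorant X n)"
proof (rule cylinder_LipschitzI[of _ M "real n"])
  show "\<bar>Lipschitz_minorant X n x\<bar> \<le> M" for x
    using Lipschitz_minorant_le_self[of X M, OF M, of n x] Lipschitz_minorant_ge[of X M, OF M, of n x] M[of x]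
    by linarith
  have one_sided: "Lipschitz_minorant X n x - real n * (\<Sum>k\<in>{0..<n}. \<bar>x k - y k\<bar>)
      \<le> Lipschitz_minorant X n y" for x y
    unfolding Lipschitz_minorant_def[of X n y]
  proof (rule cINF_greatest)
    fix z
    have "(\<Sum>k\<in>{0..<n}. \<bar>x k - z k\<bar>) \<le> (\<Sum>k\<in>{0..<n}. \<bar>x k - y k\<bar>) + (\<Sum>k\<in>{0..<n}. \<bar>y k - z k\<bar>)"
      unfolding sum.distrib[symmetric] by (intro sum_mono) linarith
    then have "real n * (\<Sum>k\<in>{0..<n}. \<bar>x k - z k\<bar>)
        \<le> real n * (\<Sum>k\<in>{0..<n}. \<bar>x k - y k\<bar>) + real n * (\<Sum>k\<in>{0..<n}. \<bar>y k - z k\<bar>)"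
      unfolding distrib_left[symmetric] by (rule mult_left_mono) simp
    then show "Lipschitz_minorant X n x - real n * (\<Sum>k\<in>{0..<n}. \<bar>x k - y k\<bar>)
        \<le> X z + real n * (\<Sum>k\<in>{0..<n}. \<bar>y k - z k\<bar>)"
      using Lipschitz_minorant_le[of X M, OF M, of n x z] by linarith
  qed simp
  show "\<bar>Lipschitz_minorant X n x - Lipschitz_minorant X n y\<bar>
      \<le> real n * (\<Sum>k\<in>{0..<n}. \<bar>x k - y k\<bar>)" for x y
    using one_sided[of x y] one_sided[of y x] by (simp add: abs_le_iff abs_minus_commute)
qed simp

text \<open>A near-minimizer \<open>w n\<close> pays at most \<open>2 M + 1\<close> for its distance from \<open>\<omega>\<close>, so each of
  its first \<open>n\<close> coordinates is within \<open>(2 M + 1) / n\<close> of \<open>\<omega>\<close>.  Hence \<open>w n\<close> tends to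
  \<open>\<omega>\<close> in the product topology, and the continuity of \<open>X\<close> bounds the minorants from below in the
  limit.\<close>

lemma Lipschitz_minorant_tendsto:
  assumes M: "\<And>x. \<bar>X x\<bar> \<le> M" and X: "continuous_on UNIV X"
  shows "(\<lambda>n. Lipschitz_minorant X n \<omega>) \<longlonglongrightarrow> X \<omega>"
proof -
  have "\<exists>w. X w + real n * (\<Sum>k\<in>{0..<n}. \<bar>\<omega> k - w k\<bar>) < Lipschitz_minorant X n \<omega> + inverse (real (Suc n))"
    for n
  proof -
    have "Lipschitz_minorant X n \<omega> < Lipschitz_minorant X n \<omega> + inverse (real (Suc n))" by simp
    then show ?thesis
      unfolding Lipschitz_minorant_def[of X n]
      by (subst (asm) cINF_less_iff) (auto intro: bdd_below_Lipschitz_minorant[of X M, OF M])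
  qed
  then obtain w where w: "\<And>n. X (w n) + real n * (\<Sum>k\<in>{0..<n}. \<bar>\<omega> k - w n k\<bar>)
      < Lipschitz_minorant X n \<omega> + inverse (real (Suc n))" by metis
  have "w \<longlonglongrightarrow> \<omega>"
    unfolding tendsto_Omega_iff
  proof
    fix k
    have "\<bar>w n k - \<omega> k\<bar> \<le> (2 * M + 1) / real n" if "Suc k \<le> n" for n
    proof -
      have "inverse (real (Suc n)) \<le> 1" by (simp add: inverse_eq_divide)
      then have "real n * (\<Sum>k\<in>{0..<n}. \<bar>\<omega> k - w n k\<bar>) \<le> 2 * M + 1"
        using w[of n] M[of "w n"] M[of \<omega>] Lipschitz_minorant_le_self[of X M, OF M, of n \<omega>] by linarith
      moreover have "\<bar>\<omega> k - w n k\<bar> \<le> (\<Sum>k\<in>{0..<n}. \<bar>\<omega> k - w n k\<bar>)"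
        using that by (intro member_le_sum) auto
      then have "real n * \<bar>\<omega> k - w n k\<bar> \<le> real n * (\<Sum>k\<in>{0..<n}. \<bar>\<omega> k - w n k\<bar>)"
        by (rule mult_left_mono) simp
      ultimately have "real n * \<bar>\<omega> k - w n k\<bar> \<le> 2 * M + 1" by linarith
      then show ?thesis using that by (simp add: field_simps abs_minus_commute)
    qed
    then have "eventually (\<lambda>n. norm (w n k - \<omega> k) \<le> (2 * M + 1) / real n) sequentially"
      unfolding eventually_sequentially by auto
    then have "(\<lambda>n. w n k - \<omega> k) \<longlonglongrightarrow> 0"
      by (rule Lim_null_comparison) (rule lim_const_over_n)
    then show "(\<lambda>n. w n k) \<longlonglongrightarrow> \<omega> k" by (rule LIM_zero_cancel)
  qed
  then have "(\<lambda>n. X (w n)) \<longlonglongrightarrow> X \<omega>"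
    by (intro continuous_on_tendsto_compose[OF X]) auto
  then have lower: "(\<lambda>n. X (w n) - inverse (real (Suc n))) \<longlonglongrightarrow> X \<omega>"
    using tendsto_diff[OF _ LIMSEQ_inverse_real_of_nat] by fastforce
  show ?thesis
  proof (rule tendsto_sandwich[OF _ _ lower tendsto_const])
    have "X (w n) - inverse (real (Suc n)) \<le> Lipschitz_minorant X n \<omega>" for n
    proof -
      have "0 \<le> real n * (\<Sum>k\<in>{0..<n}. \<bar>\<omega> k - w n k\<bar>)" by (simp add: sum_nonneg)
      then show ?thesis using w[of n] by linarith
    qed
    then show "eventually (\<lambda>n. X (w n) - inverse (real (Suc n)) \<le> Lipschitz_minorant X n \<omega>) sequentially"
      by simp
    show "eventually (\<lambda>n. Lipschitz_minorant X n \<omega> \<le> X \<omega>) sequentially"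
      using Lipschitz_minorant_le_self[of X M, OF M] by simp
  qed
qed

section \<open>Conditioning on a tail event\<close>

text \<open>A minorant from below is the right approximant: its upper expectation is at most \<open>E X\<close>
  because every member of \<open>Theta E\<close> integrates \<open>X\<close> to at most \<open>E X\<close>, and bounded pointwise
  convergence then passes the inequality to \<open>X\<close>.  A tail event belongs to every
  \<open>tail_from n\<close>, so it is later than the first \<open>n\<close> coordinates for all \<open>n\<close> at once.\<close>

lemma integral_indicator_tail_le:
  assumes iid: "backward_iid (extended_expectation E) xi" and P: "P \<in> Theta E"
    and A: "A \<in> tail_algebra" and X: "X \<in> bcontfun"
  shows "integral\<^sup>L P (\<lambda>\<omega>. X \<omega> * indicator A \<omega>) \<le> E X * measure P A"
proof -
  note bp = Theta_borel_probs[OF P]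
  interpret prob_space P using bp by (simp add: borel_probs_def)
  have [simp, measurable_cong]: "sets P = sets borel" using bp by (simp add: borel_probs_def)
  note A' [measurable] = tail_algebra_sets_borel[OF A]
  have Xc: "continuous_on UNIV X" using X by (simp add: bcontfun_def)
  have [measurable]: "X \<in> borel_measurable borel" by (rule borel_measurable_continuous_onI[OF Xc])
  obtain M where M: "\<And>x. \<bar>X x\<bar> \<le> M" using X by (auto simp: bcontfun_def bounded_iff)
  let ?m = "Lipschitz_minorant X"
  have m: "cylinder_Lipschitz 0 n (?m n)" for n by (rule cylinder_Lipschitz_minorant[of X M, OF M])
  have [measurable]: "?m n \<in> borel_measurable borel" for n
    by (rule borel_measurable_cylinder_Lipschitz[OF m])
  have mM: "\<bar>?m n x\<bar> \<le> M" for n x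
    using Lipschitz_minorant_le_self[of X M, OF M, of n x] Lipschitz_minorant_ge[of X M, OF M, of n x] M[of x]
    by linarith
  have M0: "0 \<le> M" using M[of undefined] by linarith
  have upper: "extended_expectation E (?m n) \<le> E X" for n
  proof (rule extended_expectation_least)
    show "Theta E \<noteq> {}" using P by blast
    fix Q assume Q: "Q \<in> Theta E"
    have "integral\<^sup>L Q (?m n) \<le> integral\<^sup>L Q X"
      using Lipschitz_minorant_le_self[of X M, OF M] M mM
      by (intro integral_mono integrable_borel_probs[OF Theta_borel_probs[OF Q]]) auto
    also have "\<dots> \<le> E X" using Q X by (simp add: Theta_def)
    finally show "integral\<^sup>L Q (?m n) \<le> E X" .
  qed
  have "integral\<^sup>L P (\<lambda>\<omega>. ?m n \<omega> * indicator A \<omega>) \<le> E X * prob A" for n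
  proof -
    let ?c = "extended_expectation E (?m n)"
    have int: "integrable P (\<lambda>\<omega>. ?m n \<omega> * indicator A \<omega>)"
      using mM M0 by (intro integrable_borel_probs[OF bp, of _ M]) (auto simp: indicator_def)
    have int_c: "integrable P (\<lambda>\<omega>. ?c * indicator A \<omega>)"
      by (intro integrable_borel_probs[OF bp, of _ "\<bar>?c\<bar>"]) (auto simp: indicator_def)
    have "integral\<^sup>L P (\<lambda>\<omega>. ?m n \<omega> * indicator A \<omega>) - ?c * prob A
        = integral\<^sup>L P (\<lambda>\<omega>. (?m n \<omega> - ?c) * indicator A \<omega>)"
      using int int_c by (simp add: left_diff_distrib)
    also have "\<dots> \<le> 0"
      using A by (intro integral_indicator_later_le[OF iid P m]) (simp add: tail_algebra_def)
    finally show ?thesis using mult_right_mono[OF upper, of "prob A" n] by simp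
  qed
  moreover have "(\<lambda>n. integral\<^sup>L P (\<lambda>\<omega>. ?m n \<omega> * indicator A \<omega>))
      \<longlonglongrightarrow> integral\<^sup>L P (\<lambda>\<omega>. X \<omega> * indicator A \<omega>)"
    using mM M0
    by (intro integral_dominated_convergence[of _ _ _ "\<lambda>_. M"] AE_I2 tendsto_intros
        Lipschitz_minorant_tendsto[of X M, OF M Xc]) (auto simp: indicator_def)
  ultimately show ?thesis by (intro LIMSEQ_le_const2) auto
qed

lemma conditional_tail_in_Theta:
  assumes iid: "backward_iid (extended_expectation E) xi" and P: "P \<in> Theta E"
    and A: "A \<in> tail_algebra" and pos: "measure P A > 0"
  shows "uniform_measure P A \<in> Theta E"
proof -
  have bp: "P \<in> borel_probs" using P by (rule Theta_borel_probs)
  interpret prob_space P using bp by (simp add: borel_probs_def)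
  have [simp, measurable_cong]: "sets P = sets borel" using bp by (simp add: borel_probs_def)
  note [measurable] = tail_algebra_sets_borel[OF A]
  \<comment> \<open>A real-valued density, so that the Bochner integral can be rewritten.\<close>
  have dens: "uniform_measure P A = density P (\<lambda>x. ennreal (indicator A x / prob A))"
    unfolding uniform_measure_def emeasure_eq_measure
    using pos divide_ennreal[of 1 "prob A"] by (intro density_cong) (auto simp: indicator_def)
  have "prob_space (uniform_measure P A)"
    using pos by (intro prob_space_uniform_measure) (auto simp: emeasure_eq_measure)
  then have "uniform_measure P A \<in> borel_probs" by (simp add: borel_probs_def)
  moreover have "integral\<^sup>L (uniform_measure P A) X \<le> E X" if X: "X \<in> bcontfun" for X
  proof -
    have [measurable]: "X \<in> borel_measurable borel"
      using X by (intro borel_measurable_continuous_onI) (simp add: bcontfun_def)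
    have "integral\<^sup>L (uniform_measure P A) X = integral\<^sup>L P (\<lambda>x. (indicator A x / prob A) *\<^sub>R X x)"
      unfolding dens by (intro integral_density) auto
    also have "\<dots> = integral\<^sup>L P (\<lambda>x. X x * indicator A x) / prob A"
      by (simp add: mult.commute)
    also have "\<dots> \<le> E X"
      using integral_indicator_tail_le[OF iid P A X] pos by (simp add: field_simps)
    finally show ?thesis .
  qed
  ultimately show ?thesis by (simp add: Theta_def)
qed

theorem theorem4p4:
  fixes E :: "(Omega \<Rightarrow> real) \<Rightarrow> real" and \<gamma> :: real
    and A :: "Omega set" and P :: "Omega measure"
  assumes "sublinear_expectation E"
    and "regular_expectation E"
    and "\<gamma> > 1"
    and "\<And>k. xi k \<in> Lp_space E \<gamma>"
    and "backward_iid (extended_expectation E) xi"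
    and "A \<in> tail_algebra"
    and "P \<in> extreme_measures (Theta E)"
  shows "measure P A = 0 \<or> measure P A = 1"
proof (rule ccontr)
  assume nontrivial: "\<not> (measure P A = 0 \<or> measure P A = 1)"
  have P: "P \<in> Theta E" using assms(7) by (simp add: extreme_measures_def)
  then have bp: "P \<in> borel_probs" by (rule Theta_borel_probs)
  interpret prob_space P using bp by (simp add: borel_probs_def)
  have [simp, measurable_cong]: "sets P = sets borel" using bp by (simp add: borel_probs_def)
  then have [simp]: "space P = UNIV" by (metis sets_eq_imp_space_eq space_borel)
  note [measurable] = tail_algebra_sets_borel[OF assms(6)]
  define t where "t = prob A"
  have t: "0 < t" "t < 1"
    using nontrivial prob_le_1[of A] measure_nonneg[of P A] unfolding t_def by linarith+
  have tc: "prob (- A) = 1 - t"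
    using prob_compl[of A] by (simp add: t_def Compl_eq_Diff_UNIV)
  let ?Q = "uniform_measure P A" and ?R = "uniform_measure P (- A)"
  have Q: "?Q \<in> Theta E"
    using t by (intro conditional_tail_in_Theta assms P) (simp add: t_def)
  have R: "?R \<in> Theta E"
    using t by (intro conditional_tail_in_Theta tail_algebra_Compl assms P) (simp add: tc)
  have mix: "prob B = t * measure ?Q B + (1 - t) * measure ?R B" if B: "B \<in> sets borel" for B
  proof -
    have "measure ?Q B = prob (A \<inter> B) / t" "measure ?R B = prob (- A \<inter> B) / (1 - t)"
      using t tc B by (subst measure_uniform_measure; simp add: emeasure_eq_measure t_def)+
    moreover have "prob B = prob (A \<inter> B) + prob (- A \<inter> B)"
      using B by (subst finite_measure_Union[symmetric]) (auto intro!: arg_cong[of _ _ prob])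
    ultimately show ?thesis using t by simp
  qed
  have "?Q = P"
    using assms(7) Q R t mix unfolding extreme_measures_def by blast
  moreover have "measure ?Q A = 1"
    using t by (subst measure_uniform_measure) (simp_all add: emeasure_eq_measure t_def)
  ultimately show False using t by (simp add: t_def)
qed

end
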